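(* Let $\gamma_0=\frac{\sqrt5-1}{2}$. There exist absolute constants $c_0>0$ and $C>0$ such that the following holds: for every integer $r\geq 3$, every positive integer $N$ and every real $k>0$ with $k<c_0N^{\gamma_0-C/r}$, we have $$\max_{1\leq m\leq 3Nk}\tau(m;2N,2N+2k)\leq r-1,$$ where the maximum is over positive integers $m\leq 3Nk$.
   Context: For a positive integer $m$ and reals $a\leq b$, $\tau(m;a,b)=\#\{d\in\mathbb{N}: d\mid m,\ a\leq d\leq b\}$ denotes the number of divisors of $m$ in the interval $[a,b]$. *)

theory Defs
  imports Complex_Main
begin

definition tau :: "nat \<Rightarrow> real \<Rightarrow> real \<Rightarrow> nat" where
  "tau m a b = card {d :: nat. d dvd m \<and> a \<le> real d \<and> real d \<le> b}"

definition gamma0 :: real where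
  "gamma0 = (sqrt 5 - 1) / 2"

end

theory Submission
  imports Defs "HOL-Analysis.Convex" "HOL-Number_Theory.Prime_Powers"
begin

text \<open>
  Write the logarithm of an integer as the sum of the von Mangoldt function over its divisors; this
  turns the divisors \<open>d\<close> of \<open>m\<close> into subsets of a measure space of total mass \<open>ln m\<close>, with
  \<open>gcd\<close> as intersection. By Cauchy--Schwarz, \<open>r\<close> such sets of mass at least \<open>A = ln (2N)\<close> satisfy
  \<open>r\<^sup>2 A\<^sup>2 \<le> ln m * (sum of ln (gcd a b) over all pairs a, b)\<close>. Two distinct divisors in the short
  interval have a gcd of at most \<open>2k\<close>, because it divides their difference, and
  \<open>ln m \<le> A + K\<close> with \<open>K = ln (2k)\<close>. So \<open>x = K / A\<close> satisfies \<open>x\<^sup>2 + x \<ge> 1 - 4/r\<close>, and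
  \<open>gamma0\<close> is the positive root of \<open>x\<^sup>2 + x = 1\<close>.
\<close>

lemma weighted_Cauchy_Schwarz_sum:
  fixes w f :: "'a \<Rightarrow> real"
  assumes "\<And>x. x \<in> A \<Longrightarrow> w x \<ge> 0"
  shows "(\<Sum>x\<in>A. w x * f x)\<^sup>2 \<le> (\<Sum>x\<in>A. w x) * (\<Sum>x\<in>A. w x * (f x)\<^sup>2)"
proof -
  have "(\<Sum>x\<in>A. w x * f x) = (\<Sum>x\<in>A. sqrt (w x) * (sqrt (w x) * f x))"
    using assms by (intro sum.cong) (simp_all flip: mult.assoc)
  then show ?thesis
    using Cauchy_Schwarz_ineq_sum[of "\<lambda>x. sqrt (w x)" "\<lambda>x. sqrt (w x) * f x" A] assms
    by (simp add: power_mult_distrib)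
qed

text \<open>Padding with zero terms gives the logarithms of all divisors of \<open>m\<close> one
  common index set, so that sums over several \<open>n\<close> can be interchanged.\<close>

lemma ln_eq_sum_mangoldt:
  assumes "m > 0" "n dvd m"
  shows "ln (real n) = (\<Sum>q | q dvd m. mangoldt q * of_bool (q dvd n))"
proof -
  have "n > 0"
    using assms by (auto intro: Nat.gr0I)
  then have "ln (real n) = (\<Sum>q | q dvd n. mangoldt q)"
    using mangoldt_sum[of n, where ?'a = real] by simp
  also have "\<dots> = (\<Sum>q | q dvd m. mangoldt q * of_bool (q dvd n))"
    using assms dvd_trans by (intro sum.mono_neutral_cong_left) auto
  finally show ?thesis .
qed

text \<open>Let \<open>c q\<close> count the members of \<open>S\<close> divisible by
  \<open>q\<close>. Then \<open>c q\<close> squared counts the pairs whose gcd is divisible by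
  \<open>q\<close>, so both sums over \<open>S\<close> become Mangoldt-weighted moments of
  \<open>c\<close>, and Cauchy-Schwarz compares them with the total weight
  \<open>ln m\<close>.\<close>

lemma sum_ln_divisors_squared_le:
  fixes m :: nat
  assumes "m > 0" and S: "\<And>d. d \<in> S \<Longrightarrow> d dvd m"
  shows "(\<Sum>d\<in>S. ln (real d))\<^sup>2 \<le> ln (real m) * (\<Sum>a\<in>S. \<Sum>b\<in>S. ln (real (gcd a b)))"
proof -
  define D where "D = {q. q dvd m}"
  define c :: "nat \<Rightarrow> real" where "c q = (\<Sum>d\<in>S. of_bool (q dvd d))" for q
  have sum_ln: "(\<Sum>d\<in>S. ln (real d)) = (\<Sum>q\<in>D. mangoldt q * c q)"
  proof -
    have "(\<Sum>d\<in>S. ln (real d)) = (\<Sum>d\<in>S. \<Sum>q\<in>D. mangoldt q * of_bool (q dvd d))"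
      unfolding D_def using ln_eq_sum_mangoldt \<open>m > 0\<close> S by (intro sum.cong refl) blast
    then show ?thesis
      unfolding c_def sum_distrib_left by (subst sum.swap) simp
  qed
  have sum_ln_gcd: "(\<Sum>a\<in>S. \<Sum>b\<in>S. ln (real (gcd a b))) = (\<Sum>q\<in>D. mangoldt q * (c q)\<^sup>2)"
  proof -
    have "ln (real (gcd a b)) = (\<Sum>q\<in>D. mangoldt q * (of_bool (q dvd a) * of_bool (q dvd b)))"
      if "a \<in> S" for a b
    proof -
      have "gcd a b dvd m"
        using S[OF that] by (meson dvd_trans gcd_dvd1)
      then show ?thesis
        unfolding D_def using ln_eq_sum_mangoldt[OF \<open>m > 0\<close>, of "gcd a b"]
        by (simp flip: of_bool_conj)
    qed
    then have "(\<Sum>a\<in>S. \<Sum>b\<in>S. ln (real (gcd a b))) =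
        (\<Sum>a\<in>S. \<Sum>b\<in>S. \<Sum>q\<in>D. mangoldt q * (of_bool (q dvd a) * of_bool (q dvd b)))"
      by (intro sum.cong refl) blast
    also have "\<dots> = (\<Sum>a\<in>S. \<Sum>q\<in>D. \<Sum>b\<in>S. mangoldt q * (of_bool (q dvd a) * of_bool (q dvd b)))"
      by (intro sum.cong refl sum.swap)
    also have "\<dots> = (\<Sum>q\<in>D. \<Sum>a\<in>S. \<Sum>b\<in>S. mangoldt q * (of_bool (q dvd a) * of_bool (q dvd b)))"
      by (rule sum.swap)
    also have "\<dots> = (\<Sum>q\<in>D. mangoldt q * (c q)\<^sup>2)"
      unfolding c_def power2_eq_square sum_product by (simp only: sum_distrib_left)
    finally show ?thesis .
  qed
  have "ln (real m) = (\<Sum>q\<in>D. mangoldt q)"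
    using mangoldt_sum[of m, where ?'a = real] \<open>m > 0\<close> by (simp add: D_def)
  then show ?thesis
    unfolding sum_ln sum_ln_gcd
    using weighted_Cauchy_Schwarz_sum[of D mangoldt c] mangoldt_nonneg by simp
qed

lemma gcd_le_diff:
  fixes a b :: nat
  assumes "a < b"
  shows "gcd a b \<le> b - a"
  using assms by (intro dvd_imp_le dvd_diff_nat) auto

text \<open>Diagonal pairs have gcd \<open>a\<close> and cost at most \<open>B\<close>; the others
  are controlled by their difference. As \<open>K\<close> is nonnegative, it can be charged to the
  diagonal as well, which makes every row contribute the same bound.\<close>

lemma sum_ln_gcd_le:
  fixes S :: "nat set" and B K :: real
  assumes "finite S"
    and pos: "\<And>d. d \<in> S \<Longrightarrow> d > 0"
    and B: "\<And>d. d \<in> S \<Longrightarrow> ln (real d) \<le> B"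
    and K: "\<And>a b. a \<in> S \<Longrightarrow> b \<in> S \<Longrightarrow> a < b \<Longrightarrow> ln (real (b - a)) \<le> K"
    and "K \<ge> 0"
  shows "(\<Sum>a\<in>S. \<Sum>b\<in>S. ln (real (gcd a b))) \<le> real (card S) * (B + real (card S) * K)"
proof -
  have gcd_le: "ln (real (gcd a b)) \<le> K" if "a \<in> S" "b \<in> S" "a < b" for a b
  proof -
    have "ln (real (gcd a b)) \<le> ln (real (b - a))"
      using gcd_le_diff[OF \<open>a < b\<close>] pos[OF \<open>a \<in> S\<close>] by (intro ln_mono) auto
    also have "\<dots> \<le> K"
      using K that by blast
    finally show ?thesis .
  qed
  have "ln (real (gcd a b)) \<le> of_bool (a = b) * B + K" if "a \<in> S" "b \<in> S" for a b
    using gcd_le[of a b] gcd_le[of b a] B[of a] \<open>K \<ge> 0\<close> that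
    by (cases a b rule: linorder_cases) (auto simp: gcd.commute)
  then have "(\<Sum>a\<in>S. \<Sum>b\<in>S. ln (real (gcd a b))) \<le> (\<Sum>a\<in>S. \<Sum>b\<in>S. of_bool (a = b) * B + K)"
    by (intro sum_mono)
  also have "\<dots> = (\<Sum>a\<in>S. B + real (card S) * K)"
    using \<open>finite S\<close> by (intro sum.cong refl)
      (simp add: sum.distrib of_bool_def if_distrib[of "\<lambda>x. x * B"] cong: if_cong)
  finally show ?thesis
    by simp
qed

lemma gamma0_props: "gamma0\<^sup>2 + gamma0 = 1" "gamma0 > 0" "gamma0 < 1"
proof -
  have "sqrt 5 > sqrt 1" "sqrt 5 < sqrt 9"
    by (simp_all only: real_sqrt_less_iff)
  then show "gamma0 > 0" "gamma0 < 1"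
    by (simp_all add: gamma0_def)
  show "gamma0\<^sup>2 + gamma0 = 1"
    by (simp add: gamma0_def power2_eq_square field_simps)
qed

lemma gamma0_le_of_quadratic:
  fixes A K e :: real
  assumes "A > 0" "K \<ge> 0" "e \<ge> 0"
    and quad: "A\<^sup>2 \<le> A * K + K\<^sup>2 + e * A\<^sup>2"
  shows "(gamma0 - e) * A \<le> K"
proof (rule ccontr)
  let ?t = "gamma0 * A - K"
  assume "\<not> ?thesis"
  then have *: "e * A < ?t"
    by (simp add: algebra_simps)
  then have "?t > 0"
    using assms by (smt (verit) mult_nonneg_nonneg)
  have "e * A\<^sup>2 < ?t * A"
    using * \<open>A > 0\<close> by (simp add: power2_eq_square flip: mult.assoc)
  \<comment> \<open>The new factor is the cofactor of \<open>?t\<close> in the difference of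
    \<open>x\<^sup>2 + A * x\<close> between \<open>x = gamma0 * A\<close> and
    \<open>x = K\<close>.\<close>
  also have "\<dots> \<le> ?t * (gamma0 * A + K + A)"
    using \<open>?t > 0\<close> assms gamma0_props by (intro mult_left_mono) auto
  also have "\<dots> = (gamma0\<^sup>2 + gamma0) * A\<^sup>2 - (A * K + K\<^sup>2)"
    by (simp add: power2_eq_square algebra_simps)
  finally show False
    using quad gamma0_props(1) by simp
qed

text \<open>Any family of divisors in the interval forces \<open>k\<close> to be large. The diagonal
  pairs in the gcd sum give rise to the loss \<open>4 / card S\<close> in the exponent.\<close>

lemma divisors_in_short_interval:
  fixes N m :: nat and k :: real and S :: "nat set"
  assumes "N \<ge> 1" "m \<ge> 1" "k \<le> N" and m: "real m \<le> 3 * real N * k"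
    and S: "\<And>d. d \<in> S \<Longrightarrow> d dvd m \<and> 2 * real N \<le> real d \<and> real d \<le> 2 * real N + 2 * k"
    and "card S \<ge> 2"
  shows "(2 * real N) powr (gamma0 - 4 / card S) \<le> 2 * k"
proof -
  define A where "A = ln (2 * real N)"
  define K where "K = ln (2 * k)"
  define r where "r = real (card S)"
  have "finite S"
    using \<open>card S \<ge> 2\<close> by (metis card.infinite not_numeral_le_zero)
  have "r > 0"
    using \<open>card S \<ge> 2\<close> by (simp add: r_def)
  have "\<exists>a\<in>S. \<exists>b\<in>S. a \<noteq> b"
    using \<open>card S \<ge> 2\<close> card_le_Suc0_iff_eq[OF \<open>finite S\<close>] by auto
  then obtain a b where "a \<in> S" "b \<in> S" "a < b"
    by (meson nat_neq_iff)
  then have "real a + 1 \<le> real b"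
    by simp
  \<comment> \<open>Two distinct integers in an interval of length \<open>2 * k\<close> are at least
    1 apart; this makes \<open>K\<close> nonnegative.\<close>
  then have "1 \<le> 2 * k"
    using S[OF \<open>a \<in> S\<close>] S[OF \<open>b \<in> S\<close>] by linarith
  then have "K \<ge> 0" "k > 0"
    by (simp_all add: K_def)
  have "real N \<ge> 1"
    using \<open>N \<ge> 1\<close> by simp
  then have "A > 0" and ln2_le: "ln 2 \<le> A"
    by (simp_all add: A_def)
  have "K \<le> A"
    unfolding K_def A_def using \<open>k > 0\<close> \<open>k \<le> N\<close> by (intro ln_mono) auto
  have ln_d: "A \<le> ln (real d)" "ln (real d) \<le> 2 * A" "d > 0" if "d \<in> S" for d
  proof -
    show "d > 0"
      using S[OF that] \<open>N \<ge> 1\<close> by (auto intro: Nat.gr0I)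
    show "A \<le> ln (real d)"
      unfolding A_def using S[OF that] \<open>N \<ge> 1\<close> by (intro ln_mono) auto
    \<comment> \<open>As \<open>k \<le> N\<close>, every \<open>d\<close> is at most
      \<open>4 * N\<close>, and the extra \<open>ln 2\<close> is absorbed by
      \<open>A\<close>.\<close>
    have "ln (real d) \<le> ln (2 * (2 * real N))"
      using S[OF that] \<open>k \<le> N\<close> \<open>d > 0\<close> by (intro ln_mono) auto
    also have "\<dots> = ln 2 + A"
      unfolding A_def using \<open>N \<ge> 1\<close> by (intro ln_mult_pos) auto
    finally show "ln (real d) \<le> 2 * A"
      using ln2_le by simp
  qed
  have ln_m: "ln (real m) \<le> A + K"
  proof -
    \<comment> \<open>The constant 3 in the range of \<open>m\<close> only has to be at most 4
      here.\<close>
    have "3 * real N * k \<le> (2 * real N) * (2 * k)"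
      using \<open>k > 0\<close> by simp
    then have "ln (real m) \<le> ln ((2 * real N) * (2 * k))"
      using m \<open>m \<ge> 1\<close> by (intro ln_mono) auto
    then show ?thesis
      using \<open>k > 0\<close> \<open>N \<ge> 1\<close> unfolding A_def K_def by (subst (asm) ln_mult_pos) auto
  qed
  have "(r * A)\<^sup>2 \<le> (\<Sum>d\<in>S. ln (real d))\<^sup>2"
    using sum_bounded_below[of S A "\<lambda>d. ln (real d)"] ln_d(1) \<open>r > 0\<close> \<open>A > 0\<close>
    by (intro power_mono) (auto simp: r_def)
  also have "\<dots> \<le> ln (real m) * (\<Sum>a\<in>S. \<Sum>b\<in>S. ln (real (gcd a b)))"
    using \<open>m \<ge> 1\<close> S by (intro sum_ln_divisors_squared_le) auto
  also have "\<dots> \<le> (A + K) * (r * (2 * A + r * K))"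
  proof (rule mult_mono)
    have "ln (real (b - a)) \<le> K" if "a \<in> S" "b \<in> S" "a < b" for a b
      unfolding K_def using S[of a] S[of b] that by (intro ln_mono) auto
    then show "(\<Sum>a\<in>S. \<Sum>b\<in>S. ln (real (gcd a b))) \<le> r * (2 * A + r * K)"
      unfolding r_def using ln_d \<open>K \<ge> 0\<close> \<open>finite S\<close> by (intro sum_ln_gcd_le) auto
    show "0 \<le> (\<Sum>a\<in>S. \<Sum>b\<in>S. ln (real (gcd a b)))"
    proof (intro sum_nonneg ln_ge_zero)
      fix a b assume "a \<in> S"
      then have "gcd a b > 0"
        using ln_d(3) by simp
      then show "1 \<le> real (gcd a b)"
        by linarith
    qed
  qed (use ln_m \<open>A > 0\<close> \<open>K \<ge> 0\<close> in auto)
  finally have "r * (r * A\<^sup>2) \<le> r * ((A + K) * (2 * A + r * K))"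
    by (simp add: power2_eq_square algebra_simps)
  then have "r * A\<^sup>2 \<le> (A + K) * (2 * A + r * K)"
    using \<open>r > 0\<close> by simp
  also have "\<dots> = r * (A * K + K\<^sup>2) + 2 * A * (A + K)"
    by (simp add: power2_eq_square algebra_simps)
  \<comment> \<open>The diagonal term is at most \<open>4 * A\<^sup>2\<close>; dividing by
    \<open>r\<close> yields the error \<open>4 / r\<close>.\<close>
  also have "2 * A * (A + K) \<le> 2 * A * (A + A)"
    using \<open>K \<le> A\<close> \<open>A > 0\<close> by (intro mult_left_mono) auto
  finally have "A\<^sup>2 \<le> A * K + K\<^sup>2 + 4 / r * A\<^sup>2"
    using \<open>r > 0\<close> by (simp add: power2_eq_square field_simps)
  then have "(gamma0 - 4 / r) * A \<le> K"
    using \<open>A > 0\<close> \<open>K \<ge> 0\<close> \<open>r > 0\<close> by (intro gamma0_le_of_quadratic) auto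
  then have "exp ((gamma0 - 4 / r) * A) \<le> exp K"
    by simp
  then show ?thesis
    using \<open>N \<ge> 1\<close> \<open>k > 0\<close> by (simp add: powr_def A_def K_def r_def)
qed

theorem theorem3p1:
  shows "\<exists>c0 C :: real. c0 > 0 \<and> C > 0 \<and>
    (\<forall>(r :: nat) (N :: nat) (k :: real).
      r \<ge> 3 \<longrightarrow> N \<ge> 1 \<longrightarrow> k > 0 \<longrightarrow> k < c0 * real N powr (gamma0 - C / real r) \<longrightarrow>
      (\<forall>m :: nat. 1 \<le> m \<longrightarrow> real m \<le> 3 * real N * k \<longrightarrow>
        tau m (2 * real N) (2 * real N + 2 * k) \<le> r - 1))"
\<comment> \<open>The 4 is the diagonal loss of \<open>divisors_in_short_interval\<close>; the
  factor 1/2 cancels the 2 in its conclusion \<open>... \<le> 2 * k\<close>.\<close>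
proof (rule exI[of _ "1 / 2"], rule exI[of _ 4], intro conjI allI impI)
  fix r N m :: nat and k :: real
  assume "r \<ge> 3" "N \<ge> 1" "k > 0" and k: "k < 1 / 2 * real N powr (gamma0 - 4 / real r)"
    and "1 \<le> m" and m: "real m \<le> 3 * real N * k"
  let ?T = "{d. d dvd m \<and> 2 * real N \<le> real d \<and> real d \<le> 2 * real N + 2 * k}"
  show "tau m (2 * real N) (2 * real N + 2 * k) \<le> r - 1"
  proof (rule ccontr)
    assume "\<not> ?thesis"
    then have "r \<le> card ?T"
      by (simp add: tau_def)
    \<comment> \<open>Exactly \<open>r\<close> divisors are kept, so that the exponent
      \<open>gamma0 - 4 / card S\<close> is the one in the hypothesis on \<open>k\<close>.\<close>
    then obtain S where S: "S \<subseteq> ?T" "card S = r"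
      by (meson obtain_subset_with_card_n)
    let ?e = "gamma0 - 4 / real r"
    have "real N powr ?e \<le> real N powr 1"
    proof (rule powr_mono)
      have "4 / real r \<ge> 0"
        by simp
      then show "?e \<le> 1"
        using gamma0_props(3) by linarith
    qed (use \<open>N \<ge> 1\<close> in simp)
    then have "k \<le> real N"
      using k \<open>N \<ge> 1\<close> by simp
    then have lower: "(2 * real N) powr ?e \<le> 2 * k"
      using divisors_in_short_interval[of N m k S] S \<open>r \<ge> 3\<close> \<open>N \<ge> 1\<close> \<open>1 \<le> m\<close> m by auto
    show False
    proof (cases "?e \<ge> 0")
      case True
      then have "real N powr ?e \<le> (2 * real N) powr ?e"
        by (intro powr_mono2) auto
      then show False
        using lower k by simp
    next
      \<comment> \<open>With a negative exponent, replacing \<open>2 * N\<close> by \<open>N\<close>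
        goes the wrong way. Instead the hypothesis gives \<open>2 * k < 1\<close>, and the interval
        contains no integer but \<open>2 * N\<close>.\<close>
      case False
      then have "real N powr ?e \<le> real N powr 0"
        using \<open>N \<ge> 1\<close> by (intro powr_mono) auto
      then have "2 * k < 1"
        using k \<open>N \<ge> 1\<close> by simp
      moreover have "d = 2 * N" if "d \<in> S" for d
        using S(1) that \<open>2 * k < 1\<close> by force
      then have "card S \<le> card {2 * N}"
        by (intro card_mono) auto
      ultimately show False
        using S(2) \<open>r \<ge> 3\<close> by simp
    qed
  qed
qed auto

end
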